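(* For all positive integers $n,k,D,\eta,\alpha$ such that $k/(4D\alpha\eta)$ is an integer and $n\geq 3k\cdot\left(\frac{k}{2D\alpha\eta}\right)^D$, there exists a $k$-edge-connected simple graph $G$ on $n$ vertices of diameter at most $2D+2$, such that, for any collection $\mathcal{T}=\{T_1,\ldots,T_{k/\alpha}\}$ of $k/\alpha$ spanning trees of $G$ that causes edge-congestion at most $\eta$, some tree $T_i\in\mathcal{T}$ has diameter at least $\frac14\cdot\left(\frac{k}{2D\alpha\eta}\right)^D$.
   Context: Graphs are finite, undirected and unweighted; a simple graph has no loops and no parallel edges. A collection $\mathcal{T}$ of trees in $G$ causes edge-congestion at most $\eta$ if every edge of $G$ lies in at most $\eta$ trees of $\mathcal{T}$. A graph is $k$-edge-connected if it remains connected after deletion of any set of at most $k-1$ edges. *)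

theory Defs
  imports "HOL-Library.Extended_Real"
begin

text \<open>
  A graph is given by its vertex set \<open>V\<close> and its set \<open>E\<close> of edges, an undirected edge being
  the two-element set of its endpoints. The AFP entry Graph_Theory is not used: it represents
  undirected graphs as symmetric digraphs, where the walk \<open>a, b, a\<close> counts as a cycle, so that
  its trees are not the undirected trees meant here.
\<close>

definition simple_graph :: "'a set \<Rightarrow> 'a set set \<Rightarrow> bool" where
  "simple_graph V E \<longleftrightarrow> finite V \<and> (\<forall>e\<in>E. e \<subseteq> V \<and> card e = 2)"

definition ugraph_walk :: "'a set \<Rightarrow> 'a set set \<Rightarrow> 'a \<Rightarrow> 'a list \<Rightarrow> 'a \<Rightarrow> bool" where
  "ugraph_walk V E u p v \<longleftrightarrow>
     p \<noteq> [] \<and> hd p = u \<and> last p = v \<and> set p \<subseteq> V \<and>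
     (\<forall>i. Suc i < length p \<longrightarrow> {p ! i, p ! Suc i} \<in> E)"

definition ugraph_connected :: "'a set \<Rightarrow> 'a set set \<Rightarrow> bool" where
  "ugraph_connected V E \<longleftrightarrow> V \<noteq> {} \<and> (\<forall>u\<in>V. \<forall>v\<in>V. \<exists>p. ugraph_walk V E u p v)"

definition edge_connected :: "nat \<Rightarrow> 'a set \<Rightarrow> 'a set set \<Rightarrow> bool" where
  "edge_connected k V E \<longleftrightarrow>
     (\<forall>F. F \<subseteq> E \<and> finite F \<and> card F < k \<longrightarrow> ugraph_connected V (E - F))"

text \<open>
  Walks are lists of vertices, so the length of \<open>p\<close> is \<open>length p - 1\<close>. Distances, and hence
  diameters, are extended naturals: they are infinite in a disconnected graph.
\<close>

definition ugraph_dist :: "'a set \<Rightarrow> 'a set set \<Rightarrow> 'a \<Rightarrow> 'a \<Rightarrow> enat" where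
  "ugraph_dist V E u v = (INF p\<in>{p. ugraph_walk V E u p v}. enat (length p - 1))"

definition ugraph_diameter :: "'a set \<Rightarrow> 'a set set \<Rightarrow> enat" where
  "ugraph_diameter V E = (SUP u\<in>V. SUP v\<in>V. ugraph_dist V E u v)"

text \<open>A cycle is listed without repeating its first vertex at the end.\<close>

definition ugraph_cycle :: "'a set \<Rightarrow> 'a set set \<Rightarrow> 'a list \<Rightarrow> bool" where
  "ugraph_cycle V E c \<longleftrightarrow>
     3 \<le> length c \<and> distinct c \<and> set c \<subseteq> V \<and>
     (\<forall>i. Suc i < length c \<longrightarrow> {c ! i, c ! Suc i} \<in> E) \<and> {last c, hd c} \<in> E"

definition ugraph_tree :: "'a set \<Rightarrow> 'a set set \<Rightarrow> bool" where
  "ugraph_tree V E \<longleftrightarrow> simple_graph V E \<and> ugraph_connected V E \<and> (\<nexists>c. ugraph_cycle V E c)"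

text \<open>A spanning tree of \<open>(V, E)\<close> is identified with its edge set \<open>T\<close>; its vertex set is \<open>V\<close>.\<close>

definition ugraph_spanning_tree :: "'a set \<Rightarrow> 'a set set \<Rightarrow> 'a set set \<Rightarrow> bool" where
  "ugraph_spanning_tree V E T \<longleftrightarrow> T \<subseteq> E \<and> ugraph_tree V T"

text \<open>
  A collection of trees is an indexed family \<open>T i\<close> with \<open>i \<in> I\<close> of edge sets: equal trees with different
  indices are counted separately.
\<close>

definition congestion_at_most :: "'a set set \<Rightarrow> 'i set \<Rightarrow> ('i \<Rightarrow> 'a set set) \<Rightarrow> nat \<Rightarrow> bool" where
  "congestion_at_most E I T \<eta> \<longleftrightarrow> (\<forall>e\<in>E. card {i\<in>I. e \<in> T i} \<le> \<eta>)"

end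

theory Submission
  imports Defs
begin

text \<open>
  Let \<open>w = k / (2 D \<alpha> \<eta>)\<close> and \<open>N = w ^ D\<close>. Arrange the vertices in \<open>N\<close> consecutive columns of at
  least \<open>3 k\<close> vertices each, and join all pairs within a column or in neighbouring columns; this
  makes the graph \<open>k\<close>-edge-connected. A \<open>w\<close>-ary hierarchy of shortcuts between the
  first vertices of the columns, joining the start of each block of \<open>w ^ (j + 1)\<close> columns to the
  starts of its \<open>w\<close> sub-blocks, brings the diameter down to \<open>2 D + 2\<close>.

  Only the at most \<open>D w\<close> shortcuts of the \<open>D\<close> blocks containing a column can jump over it, and
  they are used by at most \<open>D w \<eta>\<close> trees altogether, which is half of the \<open>k / \<alpha>\<close> trees.
  By double counting, some tree jumps over at most half of the columns, and its path from the first
  column to the last one has to visit all the others.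
\<close>

section \<open>Walks\<close>

lemma ugraph_walk_refl: "u \<in> V \<Longrightarrow> ugraph_walk V E u [u] u"
  by (simp add: ugraph_walk_def)

lemma ugraph_walk_Cons:
  assumes "u \<in> V" "{u, x} \<in> E" "ugraph_walk V E x p v"
  shows "ugraph_walk V E u (u # p) v"
  using assms by (auto simp: ugraph_walk_def hd_conv_nth nth_Cons split: nat.splits)

lemma ugraph_walk_edge:
  assumes "u \<in> V" "v \<in> V" "{u, v} \<in> E"
  shows "ugraph_walk V E u [u, v] v"
  by (intro ugraph_walk_Cons[OF assms(1,3)] ugraph_walk_refl assms)

lemma ugraph_walk_append:
  assumes "ugraph_walk V E u p v" "ugraph_walk V E v q x"
  shows "ugraph_walk V E u (p @ tl q) x"
  using assms
proof (induction p arbitrary: u)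
  case Nil
  then show ?case by (simp add: ugraph_walk_def)
next
  case (Cons a p)
  show ?case
  proof (cases p)
    case Nil
    with Cons.prems have "v = a" "u = a" "q = a # tl q"
      by (auto simp: ugraph_walk_def)
    with Cons.prems Nil show ?thesis by simp
  next
    case (Cons b p')
    have w: "ugraph_walk V E b p v" and e: "{a, b} \<in> E" "a \<in> V" "u = a"
      using Cons.prems(1) Cons by (force simp: ugraph_walk_def)+
    show ?thesis
      using ugraph_walk_Cons[OF e(2,1) Cons.IH[OF w Cons.prems(2)]] e by simp
  qed
qed

lemma ugraph_walk_rev:
  assumes "ugraph_walk V E u p v"
  shows "ugraph_walk V E v (rev p) u"
proof -
  have "{rev p ! i, rev p ! Suc i} \<in> E" if "Suc i < length p" for i
  proof -
    have "{p ! (length p - Suc (Suc i)), p ! Suc (length p - Suc (Suc i))} \<in> E"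
      using assms that unfolding ugraph_walk_def by auto
    then show ?thesis
      using that by (simp add: rev_nth insert_commute Suc_diff_Suc)
  qed
  then show ?thesis
    using assms by (auto simp: ugraph_walk_def hd_rev last_rev)
qed

lemma ugraph_dist_le:
  assumes "ugraph_walk V E u p v" "length p \<le> Suc l"
  shows "ugraph_dist V E u v \<le> enat l"
proof -
  have "ugraph_dist V E u v \<le> enat (length p - 1)"
    unfolding ugraph_dist_def using assms(1) by (intro INF_lower) simp
  also have "\<dots> \<le> enat l" using assms(2) by simp
  finally show ?thesis .
qed

lemma ugraph_diameter_ge:
  assumes "u \<in> V" "v \<in> V" "\<And>p. ugraph_walk V E u p v \<Longrightarrow> l \<le> length p - 1"
  shows "enat l \<le> ugraph_diameter V E"
proof -
  have "enat l \<le> ugraph_dist V E u v"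
    unfolding ugraph_dist_def using assms(3) by (intro INF_greatest) simp
  also have "\<dots> \<le> ugraph_diameter V E"
    unfolding ugraph_diameter_def using assms(1,2) by (meson SUP_upper SUP_upper2)
  finally show ?thesis .
qed

lemma ugraph_diameter_le_twice_radius:
  assumes "\<And>u. u \<in> V \<Longrightarrow> \<exists>p. ugraph_walk V E u p c \<and> length p \<le> Suc r"
  shows "ugraph_diameter V E \<le> enat (2 * r)"
  unfolding ugraph_diameter_def
proof (intro SUP_least)
  fix u v assume "u \<in> V" "v \<in> V"
  then obtain p q where p: "ugraph_walk V E u p c" "length p \<le> Suc r"
    and q: "ugraph_walk V E v q c" "length q \<le> Suc r"
    using assms by meson
  show "ugraph_dist V E u v \<le> enat (2 * r)"
    by (rule ugraph_dist_le[OF ugraph_walk_append[OF p(1) ugraph_walk_rev[OF q(1)]]])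
      (use p(2) q(2) in simp)
qed

text \<open>Charge each \<open>z\<close> whose path \<open>u\<close>, \<open>z\<close>,
  \<open>v\<close> meets \<open>F\<close> to an edge of \<open>F\<close> on that path. As
  \<open>z\<close> differs from \<open>u\<close> and \<open>v\<close>, distinct \<open>z\<close> are
  charged to distinct edges, so \<open>F\<close> is too small to block all of
  \<open>Z\<close>.\<close>

lemma common_neighbour_avoiding:
  assumes "finite F" "card F < card Z" "u \<notin> Z" "v \<notin> Z"
  shows "\<exists>z\<in>Z. {u, z} \<notin> F \<and> {z, v} \<notin> F"
proof (rule ccontr)
  assume *: "\<not> ?thesis"
  define f where "f z = (if {u, z} \<in> F then {u, z} else {z, v})" for z
  have "inj_on f Z"
    using assms(3,4) unfolding f_def inj_on_def by (auto simp: doubleton_eq_iff split: if_splits)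
  moreover have "f ` Z \<subseteq> F"
    using * by (auto simp: f_def)
  ultimately show False
    using card_inj_on_le[OF _ _ assms(1)] assms(2) by (meson not_less)
qed

section \<open>The column graph with shortcuts\<close>

text \<open>Columns are the residue classes modulo \<open>N\<close>, so the numbers below
  \<open>N\<close> are the first vertices of the columns. Residues are compared as naturals, not
  cyclically, which arranges the columns in a line.\<close>

definition column_edges :: "nat \<Rightarrow> nat \<Rightarrow> nat set set" where
  "column_edges n N = {{u, v} | u v. u < n \<and> v < n \<and> u \<noteq> v \<and>
     u mod N \<le> Suc (v mod N) \<and> v mod N \<le> Suc (u mod N)}"

text \<open>In base \<open>w\<close>, the digits of \<open>x\<close> at positions up to
  \<open>j\<close> vanish, and the edge sets digit \<open>j\<close> to \<open>c\<close>. The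
  shortcuts thus form a tree rooted at \<open>0\<close>, where the parent of a number is obtained by
  clearing its lowest nonzero digit.\<close>

definition shortcut_edges :: "nat \<Rightarrow> nat \<Rightarrow> nat set set" where
  "shortcut_edges w D = {{x, x + c * w ^ j} | x c j.
     j < D \<and> 0 < c \<and> c < w \<and> w ^ Suc j dvd x \<and> x < w ^ D}"

text \<open>The one shortcut of level \<open>j\<close> and digit \<open>c\<close> that could jump
  over column \<open>v\<close>, found by rounding \<open>v\<close> down to a multiple of
  \<open>w ^ Suc j\<close>. It need not actually pass over \<open>v\<close>.\<close>

definition jumping_shortcut :: "nat \<Rightarrow> nat \<Rightarrow> nat \<Rightarrow> nat \<Rightarrow> nat set" where
  "jumping_shortcut w v j c =
     {v div w ^ Suc j * w ^ Suc j, v div w ^ Suc j * w ^ Suc j + c * w ^ j}"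

lemma column_edgesI:
  "u < n \<Longrightarrow> v < n \<Longrightarrow> u \<noteq> v \<Longrightarrow> u mod N \<le> Suc (v mod N) \<Longrightarrow> v mod N \<le> Suc (u mod N)
    \<Longrightarrow> {u, v} \<in> column_edges n N"
  unfolding column_edges_def by blast

lemma shortcut_edgesI:
  "j < D \<Longrightarrow> 0 < c \<Longrightarrow> c < w \<Longrightarrow> w ^ Suc j dvd x \<Longrightarrow> x < w ^ D
    \<Longrightarrow> {x, x + c * w ^ j} \<in> shortcut_edges w D"
  unfolding shortcut_edges_def by blast

text \<open>The next multiple of \<open>m\<close> after \<open>x\<close> is still at most
  \<open>N\<close>.\<close>

lemma dvd_add_less:
  fixes x m N y :: nat
  assumes "m dvd x" "m dvd N" "x < N" "y < m"
  shows "x + y < N"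
proof -
  obtain a b where ab: "x = m * a" "N = m * b" using assms by (auto simp: dvd_def)
  then have "Suc a \<le> b" using assms by auto
  then have "m * Suc a \<le> N" unfolding ab by (rule mult_le_mono2)
  then show ?thesis using ab assms(4) by simp
qed

lemma shortcut_end_less:
  fixes w :: nat
  assumes "j < D" "c < w" "w ^ Suc j dvd x" "x < w ^ D"
  shows "x + c * w ^ j < w ^ D"
proof (rule dvd_add_less[OF assms(3) _ assms(4)])
  show "w ^ Suc j dvd w ^ D" using assms(1) by (intro le_imp_power_dvd) simp
  show "c * w ^ j < w ^ Suc j" using assms(2) by simp
qed

lemma jumping_shortcut_in_shortcut_edges:
  assumes "j < D" "0 < c" "c < w" "v < w ^ D"
  shows "jumping_shortcut w v j c \<in> shortcut_edges w D"
proof -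
  have "v div w ^ Suc j * w ^ Suc j < w ^ D"
    using assms(4) by (meson div_times_less_eq_dividend le_less_trans)
  then show ?thesis
    unfolding jumping_shortcut_def using assms(1-3) by (intro shortcut_edgesI dvd_triv_right)
qed

text \<open>A shortcut of level \<open>j\<close> stays inside the block of length
  \<open>w ^ Suc j\<close> starting at \<open>x\<close>, so any \<open>v\<close> strictly between
  its ends rounds down to \<open>x\<close>.\<close>

lemma jumping_shortcutI:
  assumes "w ^ Suc j dvd x" "c < w" "x < v" "v < x + c * w ^ j"
  shows "{x, x + c * w ^ j} = jumping_shortcut w v j c"
proof -
  obtain m where m: "x = w ^ Suc j * m" using assms(1) by blast
  have "c * w ^ j < w ^ Suc j" using assms(2,3,4) by (cases "w ^ j = 0") auto
  then have "v < x + w ^ Suc j" using assms(4) by linarith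
  then have "v div w ^ Suc j = m"
    using assms(3) m by (intro div_nat_eqI) (auto simp: algebra_simps)
  then show ?thesis using m by (simp add: jumping_shortcut_def mult.commute)
qed

locale column_graph =
  fixes n k w D :: nat
  assumes w: "2 \<le> w" and D: "0 < D" and k: "0 < k" and n: "3 * k * w ^ D \<le> n"
begin

abbreviation N :: nat where "N \<equiv> w ^ D"
abbreviation E :: "nat set set" where "E \<equiv> column_edges n N \<union> shortcut_edges w D"

lemma N_ge: "2 \<le> N"
  using self_le_power[of w D] w D by linarith

lemma N_le: "N \<le> n"
proof -
  have "1 * N \<le> 3 * k * N" using k by (intro mult_le_mono1) simp
  then show ?thesis using n by linarith
qed

lemma mod_N_less: "u mod N < N"
  using N_ge by (intro mod_less_divisor) linarith

lemma simple_graph: "simple_graph {..<n} E"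
  unfolding simple_graph_def
proof (intro conjI ballI)
  fix e assume "e \<in> E"
  then consider u v where "e = {u, v}" "u < n" "v < n" "u \<noteq> v"
    | x c j where "e = {x, x + c * w ^ j}" "0 < c" "x < N" "x + c * w ^ j < N"
    unfolding column_edges_def shortcut_edges_def using shortcut_end_less by blast
  then have "e \<subseteq> {..<n} \<and> card e = 2"
  proof cases
    case 1
    then show ?thesis by simp
  next
    case 2
    then have "x < n" "x + c * w ^ j < n" using N_le by linarith+
    then show ?thesis using 2 w by simp
  qed
  then show "e \<subseteq> {..<n}" "card e = 2" by simp_all
qed simp

section \<open>Edge-connectivity\<close>

lemma card_column:
  assumes "c < N"
  shows "3 * k \<le> card {u. u < n \<and> u mod N = c}"
proof -
  have "inj_on (\<lambda>i. i * N + c) {..<3 * k}"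
    using w by (auto simp: inj_on_def)
  moreover have "(\<lambda>i. i * N + c) ` {..<3 * k} \<subseteq> {u. u < n \<and> u mod N = c}"
  proof clarsimp
    fix i assume "i < 3 * k"
    then have "Suc i * N \<le> 3 * k * N" by (intro mult_le_mono1) simp
    then show "i * N + c < n \<and> c mod N = c" using assms n by simp
  qed
  ultimately show ?thesis
    using card_inj_on_le[of _ "{..<3 * k}" "{u. u < n \<and> u mod N = c}"] by simp
qed

lemma connected_neighbours:
  assumes F: "finite F" "card F < k" and uv: "u < n" "v < n"
    and close: "v mod N = u mod N \<or> v mod N = Suc (u mod N)"
  shows "\<exists>p. ugraph_walk {..<n} (E - F) u p v"
proof -
  \<comment> \<open>Every vertex in the column of \<open>u\<close> other than \<open>u\<close> and
    \<open>v\<close> is a common neighbour of both. At least \<open>3 * k - 2 \<ge> k\<close> of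
    them remain, more than \<open>F\<close> has edges.\<close>
  define Z where "Z = {x. x < n \<and> x mod N = u mod N} - {u, v}"
  have "card {x. x < n \<and> x mod N = u mod N} - card {u, v} \<le> card Z"
    unfolding Z_def by (intro diff_card_le_card_Diff) simp
  moreover have "card {u, v} \<le> 2" by (simp add: card_insert_if)
  moreover have "3 * k \<le> card {x. x < n \<and> x mod N = u mod N}"
    by (intro card_column mod_N_less)
  ultimately have "card F < card Z" using F(2) by simp
  then obtain z where z: "z \<in> Z" "{u, z} \<notin> F" "{z, v} \<notin> F"
    using common_neighbour_avoiding[of F Z u v] F(1) by (auto simp: Z_def)
  then have "{u, z} \<in> column_edges n N" "{z, v} \<in> column_edges n N" "z < n"
    using close uv unfolding column_edges_def Z_def by fastforce+
  then have "ugraph_walk {..<n} (E - F) u [u, z, v] v"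
    using z uv by (intro ugraph_walk_Cons[OF _ _ ugraph_walk_edge]) auto
  then show ?thesis by blast
qed

lemma edge_connected: "edge_connected k {..<n} E"
  unfolding edge_connected_def
proof (intro allI impI)
  fix F assume "F \<subseteq> E \<and> finite F \<and> card F < k"
  then have F: "finite F" "card F < k" by auto
  have to_0: "\<exists>p. ugraph_walk {..<n} (E - F) 0 p v" if "v < n" for v
    using that
  proof (induction "v mod N" arbitrary: v)
    case 0
    then show ?case using connected_neighbours[OF F, of 0 v] N_le N_ge by simp
  next
    case (Suc c)
    have c: "c < N" using Suc.hyps(2) mod_N_less[of v] by linarith
    \<comment> \<open>The number \<open>c\<close> itself serves as the vertex of column
      \<open>c\<close> through which the walk to \<open>v\<close> passes.\<close>
    then have "c < n" "c mod N = c" using N_le by auto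
    with Suc obtain p where "ugraph_walk {..<n} (E - F) 0 p c" by metis
    moreover obtain q where "ugraph_walk {..<n} (E - F) c q v"
      using connected_neighbours[OF F, of c v] Suc.hyps(2) Suc.prems \<open>c < n\<close> \<open>c mod N = c\<close> by auto
    ultimately show ?case by (intro exI) (rule ugraph_walk_append)
  qed
  have "\<exists>p. ugraph_walk {..<n} (E - F) u p v" if "u < n" "v < n" for u v
    using to_0[OF that(1)] to_0[OF that(2)] by (meson ugraph_walk_append ugraph_walk_rev)
  then show "ugraph_connected {..<n} (E - F)"
    using N_ge N_le by (auto simp: ugraph_connected_def lessThan_empty_iff)
qed

section \<open>Upper bound on the diameter\<close>

text \<open>A multiple of \<open>w ^ (D - t)\<close> below \<open>N\<close> has at most
  \<open>t\<close> nonzero digits in base \<open>w\<close>, and one shortcut clears one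
  digit.\<close>

lemma walk_to_0:
  assumes "t \<le> D" "w ^ (D - t) dvd u" "u < N"
  shows "\<exists>p. ugraph_walk {..<n} E u p 0 \<and> length p \<le> Suc t"
  using assms
proof (induction t arbitrary: u)
  case 0
  then have "u = 0" by (auto dest: nat_dvd_not_less)
  then show ?case using N_ge N_le by (intro exI[of _ "[0]"]) (simp add: ugraph_walk_refl)
next
  case (Suc t)
  define j where "j = D - Suc t"
  have j: "j < D" "D - t = Suc j" using Suc.prems(1) by (auto simp: j_def)
  \<comment> \<open>Position \<open>j\<close> is the lowest whose digit may be nonzero. That digit
    is \<open>m mod w\<close> for the \<open>m\<close> below, and \<open>x\<close> is
    \<open>u\<close> with it cleared.\<close>
  define x where "x = u div w ^ Suc j * w ^ Suc j"
  obtain m where m: "u = w ^ j * m" using Suc.prems(2) unfolding j_def by blast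
  have "u div w ^ Suc j = m div w"
    using w by (simp add: m div_mult2_eq mult.commute[of w])
  then have u: "u = x + (m mod w) * w ^ j"
    using div_mult_mod_eq[of m w, symmetric]
    by (simp add: x_def m mult.commute[of "w ^ j"] flip: distrib_right mult.assoc)
  have x: "x < N" "w ^ Suc j dvd x"
    using u Suc.prems(3) by (auto simp: x_def)
  then obtain p where p: "ugraph_walk {..<n} E x p 0" "length p \<le> Suc t"
    using Suc.IH[of x] Suc.prems(1) j(2) by auto
  show ?case
  proof (cases "m mod w = 0")
    case True
    then show ?thesis using u p le_SucI by auto
  next
    case False
    then have "{x, u} \<in> shortcut_edges w D"
      unfolding u using x j(1) w by (intro shortcut_edgesI) auto
    then have "{u, x} \<in> E" by (simp add: insert_commute)
    then have "ugraph_walk {..<n} E u (u # p) 0"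
      using p(1) Suc.prems(3) N_le by (intro ugraph_walk_Cons) auto
    then show ?thesis using p(2) by (intro exI[of _ "u # p"]) simp
  qed
qed

text \<open>One column edge leads to the first vertex of the column and at most \<open>D\<close>
  shortcuts lead on to \<open>0\<close>, so the radius around \<open>0\<close> is at most
  \<open>D + 1\<close>.\<close>

lemma diameter_le: "ugraph_diameter {..<n} E \<le> enat (2 * D + 2)"
proof -
  have "\<exists>p. ugraph_walk {..<n} E u p 0 \<and> length p \<le> Suc (Suc D)" if "u \<in> {..<n}" for u
  proof -
    have r: "u mod N < N" by (rule mod_N_less)
    then obtain p where p: "ugraph_walk {..<n} E (u mod N) p 0" "length p \<le> Suc D"
      using walk_to_0[of D "u mod N"] by auto
    show ?thesis
    proof (cases "u mod N = u")
      case True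
      then show ?thesis using p by (auto intro: le_SucI)
    next
      case False
      then have "{u, u mod N} \<in> column_edges n N"
        using that r N_le by (intro column_edgesI) auto
      then have "ugraph_walk {..<n} E u (u # p) 0"
        using p(1) that by (intro ugraph_walk_Cons) auto
      then show ?thesis using p(2) by (intro exI[of _ "u # p"]) simp
    qed
  qed
  then show ?thesis
    using ugraph_diameter_le_twice_radius[of "{..<n}" E 0 "Suc D"] by simp
qed

section \<open>Columns that a tree cannot jump over\<close>

text \<open>All candidates at \<open>v\<close> are excluded, even those that do not pass over
  \<open>v\<close>. This suffices against jumps and leaves a family of \<open>D * (w - 1)\<close>
  candidates to count.\<close>

definition good :: "nat set set \<Rightarrow> nat \<Rightarrow> bool" where
  "good T v \<longleftrightarrow> (\<forall>j<D. \<forall>c\<in>{1..<w}. jumping_shortcut w v j c \<notin> T)"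

lemma good_not_jumped:
  assumes "T \<subseteq> E" "good T v" "{a, b} \<in> T" "a mod N < v"
  shows "b mod N \<le> v"
proof (rule ccontr)
  assume "\<not> ?thesis"
  then have b: "v < b mod N" by simp
  \<comment> \<open>A column edge changes the column by at most one, but here \<open>v\<close> lies
    strictly between.\<close>
  have "{a, b} \<notin> column_edges n N"
    using b assms(4) by (auto simp: column_edges_def doubleton_eq_iff)
  then obtain x c j where x: "{a, b} = {x, x + c * w ^ j}" "j < D" "0 < c" "c < w"
      "w ^ Suc j dvd x" "x < N"
    using assms(1,3) unfolding shortcut_edges_def by blast
  \<comment> \<open>Both ends lie below \<open>N\<close>, so they are their own column
    numbers.\<close>
  have "x + c * w ^ j < N" using shortcut_end_less x by blast
  with x(1,6) b assms(4) have "x < v" "v < x + c * w ^ j"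
    by (auto simp: doubleton_eq_iff)
  then have "{a, b} = jumping_shortcut w v j c" using jumping_shortcutI x by metis
  then show False using assms(2,3) x unfolding good_def by auto
qed

text \<open>A walk from \<open>0\<close> that avoids column \<open>v\<close> stays in columns below
  \<open>v\<close>, by \<open>good_not_jumped\<close>, and so never reaches column
  \<open>N - 1\<close>.\<close>

lemma walk_visits_good:
  assumes T: "T \<subseteq> E" and v: "good T v" "v < N"
    and p: "ugraph_walk {..<n} T 0 p (N - 1)"
  shows "v \<in> (\<lambda>u. u mod N) ` set p"
proof (rule ccontr)
  assume no: "\<not> ?thesis"
  have p': "p \<noteq> []" "p ! 0 = 0" "p ! (length p - 1) = N - 1"
    "\<And>i. Suc i < length p \<Longrightarrow> {p ! i, p ! Suc i} \<in> T"
    using p by (auto simp: ugraph_walk_def hd_conv_nth last_conv_nth)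
  have ne: "p ! i mod N \<noteq> v" if "i < length p" for i
    using no that by auto
  have "p ! i mod N < v" if "i < length p" for i
    using that
  proof (induction i)
    case 0
    then show ?case using ne[of 0] p'(2) by simp
  next
    case (Suc i)
    then show ?case
      using good_not_jumped[OF T v(1) p'(4)[of i]] ne[of "Suc i"] by simp
  qed
  from this[of "length p - 1"] show False
    using p'(1,3) v(2) N_ge by simp
qed

lemma tree_diameter_ge:
  assumes T: "T \<subseteq> E" and half: "N \<le> 2 * card {v. v < N \<and> good T v}"
  shows "enat ((N + 3) div 4) \<le> ugraph_diameter {..<n} T"
proof (rule ugraph_diameter_ge)
  show "0 \<in> {..<n}" "N - 1 \<in> {..<n}" using N_ge N_le by auto
  fix p assume p: "ugraph_walk {..<n} T 0 p (N - 1)"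
  have "{v. v < N \<and> good T v} \<subseteq> (\<lambda>u. u mod N) ` set p"
    using walk_visits_good[OF T _ _ p] by auto
  then have "card {v. v < N \<and> good T v} \<le> card ((\<lambda>u. u mod N) ` set p)"
    by (intro card_mono) auto
  also have "\<dots> \<le> length p"
    using card_image_le[of "set p"] card_length[of p] by (meson List.finite_set le_trans)
  finally have "N \<le> 2 * length p" using half by simp
  \<comment> \<open>The ends \<open>0\<close> and \<open>N - 1\<close> differ. With two vertices or
    more, \<open>length p - 1\<close> is at least half of \<open>length p\<close>, hence at least
    \<open>N / 4\<close>, which \<open>(N + 3) div 4\<close> rounds up.\<close>
  moreover have "2 \<le> length p"
    using p N_ge by (cases p rule: remdups_adj.cases) (auto simp: ugraph_walk_def)
  ultimately show "(N + 3) div 4 \<le> length p - 1" by simp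
qed

text \<open>A tree for which \<open>v\<close> is not good contains one of the
  \<open>D * (w - 1)\<close> candidates at \<open>v\<close>, and each candidate lies in at most
  \<open>\<eta>\<close> trees.\<close>

lemma card_not_good_le:
  assumes "congestion_at_most E I T \<eta>" "finite I" "v < N"
  shows "card {i\<in>I. \<not> good (T i) v} \<le> D * w * \<eta>"
proof -
  define S where "S = {..<D} \<times> {1..<w}"
  have "{i\<in>I. \<not> good (T i) v} = (\<Union>(j, c)\<in>S. {i\<in>I. jumping_shortcut w v j c \<in> T i})"
    by (auto simp: good_def S_def)
  also have "card \<dots> \<le> (\<Sum>(j, c)\<in>S. card {i\<in>I. jumping_shortcut w v j c \<in> T i})"
    unfolding case_prod_unfold by (rule card_UN_le) (simp add: S_def)
  also have "\<dots> \<le> (\<Sum>(j, c)\<in>S. \<eta>)"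
    using assms(1,3) jumping_shortcut_in_shortcut_edges[of _ D _ w v]
    by (intro sum_mono) (auto simp: S_def congestion_at_most_def)
  also have "\<dots> = D * (w - 1) * \<eta>" by (simp add: S_def case_prod_unfold)
  also have "\<dots> \<le> D * w * \<eta>" by simp
  finally show ?thesis .
qed

text \<open>Count the pairs of a column \<open>v\<close> and an index \<open>i\<close> with
  \<open>v\<close> good for \<open>T i\<close>. Each column is good for at least half of the trees;
  were the claim false, each tree would have fewer than \<open>N / 2\<close> good columns.\<close>

lemma exists_half_good:
  assumes T: "congestion_at_most E I T \<eta>" and I: "finite I" "I \<noteq> {}" "2 * D * w * \<eta> \<le> card I"
  shows "\<exists>i\<in>I. N \<le> 2 * card {v. v < N \<and> good (T i) v}"
proof (rule ccontr)
  assume "\<not> ?thesis"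
  then have less: "2 * card {v\<in>{..<N}. good (T i) v} < N" if "i \<in> I" for i
    using that by (auto simp: not_le)
  have "N * card I \<le> (\<Sum>v<N. 2 * card {i\<in>I. good (T i) v})"
  proof -
    have "card I \<le> 2 * card {i\<in>I. good (T i) v}" if "v < N" for v
    proof -
      have "card I = card ({i\<in>I. good (T i) v} \<union> {i\<in>I. \<not> good (T i) v})"
        by (rule arg_cong[where f = card]) auto
      also have "\<dots> \<le> card {i\<in>I. good (T i) v} + card {i\<in>I. \<not> good (T i) v}"
        by (rule card_Un_le)
      finally show ?thesis using card_not_good_le[OF T I(1) that] I(3) by simp
    qed
    then have "(\<Sum>v<N. card I) \<le> (\<Sum>v<N. 2 * card {i\<in>I. good (T i) v})"
      by (intro sum_mono) simp
    then show ?thesis by simp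
  qed
  also have "\<dots> = 2 * (\<Sum>i\<in>I. card {v\<in>{..<N}. good (T i) v})"
    using sum_multicount_gen[of "{..<N}" I "\<lambda>v i. good (T i) v" "\<lambda>i. card {v\<in>{..<N}. good (T i) v}"] I(1)
    by (simp flip: sum_distrib_left)
  also have "\<dots> = (\<Sum>i\<in>I. 2 * card {v\<in>{..<N}. good (T i) v})"
    by (simp add: sum_distrib_left)
  also have "\<dots> < (\<Sum>i\<in>I. N)"
    using less I by (intro sum_strict_mono) auto
  finally show False by simp
qed

end

theorem theorem1p3:
  fixes n k D \<eta> \<alpha> :: nat
  assumes "n > 0" and "k > 0" and "D > 0" and "\<eta> > 0" and "\<alpha> > 0"
    and "4 * D * \<alpha> * \<eta> dvd k"
    and "real n \<ge> 3 * real k * (real k / (2 * real D * real \<alpha> * real \<eta>)) ^ D"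
  shows "\<exists>(V :: nat set) E.
           simple_graph V E \<and> card V = n \<and> edge_connected k V E \<and>
           ugraph_diameter V E \<le> enat (2 * D + 2) \<and>
           (\<forall>T :: nat \<Rightarrow> nat set set.
              (\<forall>i\<in>{1..k div \<alpha>}. ugraph_spanning_tree V E (T i)) \<and>
              congestion_at_most E {1..k div \<alpha>} T \<eta> \<longrightarrow>
              (\<exists>i\<in>{1..k div \<alpha>}.
                 ereal_of_enat (ugraph_diameter V (T i)) \<ge>
                 ereal (1 / 4 * (real k / (2 * real D * real \<alpha> * real \<eta>)) ^ D)))"
proof -
  obtain q where q: "k = 4 * D * \<alpha> * \<eta> * q" using assms(6) by blast
  \<comment> \<open>Divisibility by \<open>4 * D * \<alpha> * \<eta>\<close> makes \<open>w\<close>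
    an even integer; as \<open>k > 0\<close> it is positive, so \<open>2 \<le> w\<close> as the
    locale demands.\<close>
  define w where "w = 2 * q"
  have w_real: "real k / (2 * real D * real \<alpha> * real \<eta>) = real w"
    using assms by (simp add: q w_def)
  have "real (3 * k * w ^ D) \<le> real n"
    using assms(7) unfolding w_real by simp
  then interpret column_graph n k w D
    using assms(2,3) q by unfold_locales (auto simp: w_def simp flip: of_nat_power of_nat_mult)
  \<comment> \<open>The number of trees is exactly twice the bound of
    \<open>card_not_good_le\<close>.\<close>
  have kdiv: "k div \<alpha> = 2 * D * w * \<eta>"
    using assms(5) by (simp add: q w_def)
  have large: "\<exists>i\<in>{1..k div \<alpha>}. ereal (1 / 4 * real w ^ D) \<le> ereal_of_enat (ugraph_diameter {..<n} (T i))"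
    if trees: "\<forall>i\<in>{1..k div \<alpha>}. ugraph_spanning_tree {..<n} E (T i)"
      and cong: "congestion_at_most E {1..k div \<alpha>} T \<eta>" for T :: "nat \<Rightarrow> nat set set"
  proof -
    have "{1..k div \<alpha>} \<noteq> {}"
      using kdiv w assms(3,4) by simp
    then obtain i where i: "i \<in> {1..k div \<alpha>}" "N \<le> 2 * card {v. v < N \<and> good (T i) v}"
      using exists_half_good[OF cong] kdiv by auto
    have "enat ((N + 3) div 4) \<le> ugraph_diameter {..<n} (T i)"
      using trees i by (intro tree_diameter_ge) (auto simp: ugraph_spanning_tree_def)
    then have "ereal (real ((N + 3) div 4)) \<le> ereal_of_enat (ugraph_diameter {..<n} (T i))"
      by (metis ereal_of_enat_le_iff ereal_of_enat_simps(1))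
    moreover have "N \<le> 4 * ((N + 3) div 4)" by simp
    then have "1 / 4 * real w ^ D \<le> real ((N + 3) div 4)"
      by (simp flip: of_nat_power)
    ultimately have "ereal (1 / 4 * real w ^ D) \<le> ereal_of_enat (ugraph_diameter {..<n} (T i))"
      by (meson ereal_less_eq(3) order_trans)
    with i(1) show ?thesis by blast
  qed
  show ?thesis
    unfolding w_real
    using simple_graph edge_connected diameter_le large
    by (intro exI[of _ "{..<n}"] exI[of _ E]) auto
qed

end
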